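(* For each $p\in[1,\infty]$, the class $\mathscr{S}_{\{\ell_p^n : n\in\mathbb{N}\}}$, given on each pair $X,Y$ of Banach spaces by $$\mathscr{S}_{\{\ell_p^n : n\in\mathbb{N}\}}(X,Y)=\bigl\{T\in\mathscr{B}(X,Y): T\text{ does not fix the family }\{\ell_p^n:n\in\mathbb{N}\}\text{ uniformly}\bigr\},$$ is a closed operator ideal in the sense of Pietsch.
   Context: All Banach spaces are over the same scalar field $\mathbb{K}$, either $\mathbb{R}$ or $\mathbb{C}$. An operator is a bounded, linear mapping between Banach spaces; $\mathscr{B}(X,Y)$ is the Banach space of all operators from $X$ to $Y$. The space $\ell_p^n$ is $\mathbb{K}^n$ with the $\ell_p$-norm. An operator $T\colon X\to Y$ is bounded below by $c>0$ if $\|Tx\|\geqslant c\|x\|$ for each $x\in X$. For $C\geqslant 1$ and a Banach space $E$, an operator $T\colon X\to Y$ $C$-fixes a copy of $E$ if there is an operator $S\colon E\to X$ of norm at most $C$ such that $TS$ is bounded below by $1/C$. For a non-empty family $\mathfrak{F}$ of Banach spaces, $T$ fixes the family $\mathfrak{F}$ uniformly if there is a constant $C\geqslant 1$ such that $T$ $C$-fixes a copy of each Banach space in $\mathfrak{F}$. A class $\mathscr{I}$ assigning to each pair $X,Y$ of Banach spaces a subset $\mathscr{I}(X,Y)$ of $\mathscr{B}(X,Y)$ is a closed operator ideal in the sense of Pietsch if each $\mathscr{I}(X,Y)$ is a norm-closed linear subspace of $\mathscr{B}(X,Y)$ containing all finite-rank operators, and $STR\in\mathscr{I}(W,Z)$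 whenever $R\in\mathscr{B}(W,X)$, $T\in\mathscr{I}(X,Y)$ and $S\in\mathscr{B}(Y,Z)$ for Banach spaces $W,X,Y,Z$. *)

theory Defs
  imports
    "HOL-Analysis.Abstract_Metric_Spaces"
    "HOL-Library.Extended_Nonnegative_Real"
    "Jordan_Normal_Form.VS_Connect"
begin

text \<open>
  A normed space over the scalar field \<open>'k\<close> (later \<open>real\<close> or \<open>complex\<close>) is an explicit carrier
  structure: a module record in the sense of HOL-Algebra, over \<open>class_ring\<close>, together with a norm.
  Thus \<open>all Banach spaces\<close> can be quantified over inside a formula; the elements are drawn from
  a type \<open>'a\<close> that remains arbitrary. As in \<open>module_vec\<close>, the ring fields \<open>mult\<close> and \<open>one\<close> of
  the record carry no meaning.
\<close>

record ('k, 'a) normed_space = "('k, 'a) module" +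
  vnorm :: "'a \<Rightarrow> real"

text \<open>The default value 0 off the carrier is there because \<open>Metric_space\<close> demands symmetry and
  nonnegativity on the whole type.\<close>

definition ndist :: "('k, 'a) normed_space \<Rightarrow> 'a \<Rightarrow> 'a \<Rightarrow> real" where
  "ndist X x y =
    (if x \<in> carrier X \<and> y \<in> carrier X then vnorm X (x \<ominus>\<^bsub>X\<^esub> y) else 0)"

locale normed_vectorspace = vectorspace class_ring X
  for X :: "('k::real_normed_field, 'a) normed_space" +
  assumes vnorm_nonneg: "x \<in> carrier X \<Longrightarrow> 0 \<le> vnorm X x"
    and vnorm_eq_0_iff: "x \<in> carrier X \<Longrightarrow> vnorm X x = 0 \<longleftrightarrow> x = \<zero>\<^bsub>X\<^esub>"
    and vnorm_smult: "x \<in> carrier X \<Longrightarrow> vnorm X (c \<odot>\<^bsub>X\<^esub> x) = norm c * vnorm X x"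
    and vnorm_triangle:
      "x \<in> carrier X \<Longrightarrow> y \<in> carrier X \<Longrightarrow> vnorm X (x \<oplus>\<^bsub>X\<^esub> y) \<le> vnorm X x + vnorm X y"

locale banach_space = normed_vectorspace +
  assumes complete: "Metric_space.mcomplete (carrier X) (ndist X)"

text \<open>
  Operators are functions that are \<open>undefined\<close> outside the carrier of their domain, so that
  equality of operators is equality of functions.
\<close>

definition operators ::
  "('k::real_normed_field, 'a) normed_space \<Rightarrow> ('k, 'b) normed_space \<Rightarrow> ('a \<Rightarrow> 'b) set" where
  "operators X Y = {T \<in> module_hom class_ring X Y \<inter> extensional (carrier X).
     \<exists>M. \<forall>x\<in>carrier X. vnorm Y (T x) \<le> M * vnorm X x}"

definition op_norm ::
  "('k, 'a) normed_space \<Rightarrow> ('k, 'b) normed_space \<Rightarrow> ('a \<Rightarrow> 'b) \<Rightarrow> real" where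
  "op_norm X Y T = (SUP x\<in>{x \<in> carrier X. vnorm X x \<le> 1}. vnorm Y (T x))"

definition op_space ::
  "('k::real_normed_field, 'a) normed_space \<Rightarrow> ('k, 'b) normed_space
    \<Rightarrow> ('k, 'a \<Rightarrow> 'b) normed_space" where
  "op_space X Y =
    \<lparr>carrier = operators X Y,
     mult = undefined,
     one = undefined,
     zero = (\<lambda>x\<in>carrier X. \<zero>\<^bsub>Y\<^esub>),
     add = (\<lambda>S T. \<lambda>x\<in>carrier X. S x \<oplus>\<^bsub>Y\<^esub> T x),
     smult = (\<lambda>c T. \<lambda>x\<in>carrier X. c \<odot>\<^bsub>Y\<^esub> T x),
     vnorm = op_norm X Y\<rparr>"

definition finite_rank_operators ::
  "('k::real_normed_field, 'a) normed_space \<Rightarrow> ('k, 'b) normed_space \<Rightarrow> ('a \<Rightarrow> 'b) set" where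
  "finite_rank_operators X Y =
    {T \<in> operators X Y. vectorspace.fin_dim class_ring (Y\<lparr>carrier := T ` carrier X\<rparr>)}"

definition bounded_below_by ::
  "real \<Rightarrow> ('k, 'a) normed_space \<Rightarrow> ('k, 'b) normed_space \<Rightarrow> ('a \<Rightarrow> 'b) \<Rightarrow> bool" where
  "bounded_below_by c X Y T \<longleftrightarrow> (\<forall>x\<in>carrier X. c * vnorm X x \<le> vnorm Y (T x))"

definition fixes_copy ::
  "real \<Rightarrow> ('k::real_normed_field, 'e) normed_space \<Rightarrow> ('k, 'a) normed_space
    \<Rightarrow> ('k, 'b) normed_space \<Rightarrow> ('a \<Rightarrow> 'b) \<Rightarrow> bool" where
  "fixes_copy C E X Y T \<longleftrightarrow>
    (\<exists>S\<in>operators E X. op_norm E X S \<le> C \<and>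
       bounded_below_by (1 / C) E Y (compose (carrier E) T S))"

definition fixes_uniformly ::
  "('k::real_normed_field, 'e) normed_space set \<Rightarrow> ('k, 'a) normed_space
    \<Rightarrow> ('k, 'b) normed_space \<Rightarrow> ('a \<Rightarrow> 'b) \<Rightarrow> bool" where
  "fixes_uniformly F X Y T \<longleftrightarrow> (\<exists>C\<ge>1. \<forall>E\<in>F. fixes_copy C E X Y T)"

definition non_fixing ::
  "('k::real_normed_field, 'e) normed_space set \<Rightarrow> ('k, 'a) normed_space
    \<Rightarrow> ('k, 'b) normed_space \<Rightarrow> ('a \<Rightarrow> 'b) set" where
  "non_fixing F X Y = {T \<in> operators X Y. \<not> fixes_uniformly F X Y T}"

text \<open>
  The locale predicate \<open>VectorSpace.subspace\<close> is the algebraic notion (linear subspace);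
  topological closedness is with respect to the operator norm.
\<close>

definition closed_operator_ideal ::
  "(('k::real_normed_field, 'a) normed_space \<Rightarrow> ('k, 'a) normed_space \<Rightarrow> ('a \<Rightarrow> 'a) set) \<Rightarrow> bool"
  where
  "closed_operator_ideal I \<longleftrightarrow>
    (\<forall>X Y. banach_space X \<longrightarrow> banach_space Y \<longrightarrow>
       VectorSpace.subspace class_ring (I X Y) (op_space X Y) \<and>
       closedin (Metric_space.mtopology (operators X Y) (ndist (op_space X Y))) (I X Y) \<and>
       finite_rank_operators X Y \<subseteq> I X Y) \<and>
    (\<forall>W X Y Z. banach_space W \<longrightarrow> banach_space X \<longrightarrow> banach_space Y \<longrightarrow> banach_space Z \<longrightarrow>
       (\<forall>R\<in>operators W X. \<forall>T\<in>I X Y. \<forall>S\<in>operators Y Z.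
          compose (carrier W) S (compose (carrier W) T R) \<in> I W Z))"

definition lp_norm :: "ennreal \<Rightarrow> 'k::real_normed_field vec \<Rightarrow> real" where
  "lp_norm p x =
    (if p = \<infinity> then Max (insert 0 ((\<lambda>i. norm (vec_index x i)) ` {..<dim_vec x}))
     else (\<Sum>i<dim_vec x. norm (vec_index x i) powr enn2real p) powr (1 / enn2real p))"

definition lp_space :: "ennreal \<Rightarrow> nat \<Rightarrow> ('k::real_normed_field, 'k vec) normed_space" where
  "lp_space p n = module.extend (module_vec TYPE('k) n) \<lparr>vnorm = lp_norm p\<rparr>"

definition lp_family :: "ennreal \<Rightarrow> ('k::real_normed_field, 'k vec) normed_space set" where
  "lp_family p = {lp_space p n | n. n \<ge> 1}"

end

theory Submission
  imports Defs "Jordan_Normal_Form.DL_Rank"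
begin

text \<open>
  Everything except closure under addition is soft. An operator close to \<open>T\<close> is bounded below
  wherever \<open>T\<close> is, with a slightly worse constant (\<open>fixes_copy_perturb\<close>), so the non-fixing
  operators form a norm-closed set. If \<open>S T R\<close> fixes a family uniformly through operators \<open>U\<close>,
  then \<open>T\<close> fixes it through the operators \<open>R U\<close> (\<open>fixes_uniformly_factor\<close>); this also covers
  scalar multiples. An operator that is bounded below on an \<open>n\<close>-dimensional space has rank at
  least \<open>n\<close>, which disposes of the finite-rank operators.

  For sums, let \<open>T = T\<^sub>1 + T\<^sub>2\<close> fix every \<open>\<ell>\<^sub>p\<^sup>n\<close> with the constant \<open>C\<close>, and suppose
  that \<open>T\<^sub>1\<close> does not fix these spaces uniformly. The failure of \<open>T\<^sub>1\<close> may be used with a constant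
  that depends on \<open>n\<close>: there is an \<open>m\<close> such that \<open>T\<^sub>1\<close> does not \<open>2nC\<close>-fix a copy of \<open>\<ell>\<^sub>p\<^sup>m\<close>.
  Let \<open>S\<close> witness that \<open>T\<close> fixes \<open>\<ell>\<^sub>p\<^sup>N\<close> for \<open>N = nm\<close>, and cut the \<open>N\<close> coordinates into \<open>n\<close>
  consecutive blocks of length \<open>m\<close>. Each block spans an isometric copy of \<open>\<ell>\<^sub>p\<^sup>m\<close>, so by the
  choice of \<open>m\<close> it contains a unit vector \<open>u\<^sub>j\<close> with \<open>\<parallel>T\<^sub>1 S u\<^sub>j\<parallel> \<le> 1 / (2nC)\<close>. Disjointly supported
  unit vectors span an isometric copy of \<open>\<ell>\<^sub>p\<^sup>n\<close>. On it the triangle inequality gives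
  \<open>\<parallel>T\<^sub>1 S \<Sum>\<^sub>j a\<^sub>j u\<^sub>j\<parallel> \<le> \<Sum>\<^sub>j |a\<^sub>j| / (2nC) \<le> \<parallel>a\<parallel> / (2C)\<close>, because each \<open>|a\<^sub>j|\<close> is at most \<open>\<parallel>a\<parallel>\<close>.
  Thus \<open>T\<^sub>1\<close> is only a small perturbation there, and \<open>T\<^sub>2\<close> fixes \<open>\<ell>\<^sub>p\<^sup>n\<close> with the constant \<open>2C\<close>,
  which does not depend on \<open>n\<close>. This is \<open>fixes_uniformly_lp_summand\<close>.
\<close>

section \<open>Normed spaces and operator norms\<close>

text \<open>
  Homogeneity and definiteness of the norm of the domain make a bound on the unit ball equivalent
  to a pointwise bound. The spaces \<open>\<ell>\<^sub>p\<^sup>n\<close> enter only as domains of witnesses, so for them these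
  properties take the place of Minkowski's inequality.
\<close>

locale homogeneous_norm = vectorspace class_ring X
  for X :: "('k::real_normed_field, 'a) normed_space" +
  assumes vnorm_nonneg: "x \<in> carrier X \<Longrightarrow> 0 \<le> vnorm X x"
    and vnorm_eq_0_iff: "x \<in> carrier X \<Longrightarrow> vnorm X x = 0 \<longleftrightarrow> x = \<zero>\<^bsub>X\<^esub>"
    and vnorm_smult: "x \<in> carrier X \<Longrightarrow> vnorm X (c \<odot>\<^bsub>X\<^esub> x) = norm c * vnorm X x"

lemma (in normed_vectorspace) homogeneous_norm: "homogeneous_norm X"
  by unfold_locales (auto simp: vnorm_nonneg vnorm_eq_0_iff vnorm_smult)

lemma (in homogeneous_norm) vnorm_zero: "vnorm X \<zero>\<^bsub>X\<^esub> = 0"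
  by (simp add: vnorm_eq_0_iff)

lemma (in vectorspace) smult_minus_one:
  "x \<in> carrier V \<Longrightarrow> (\<ominus>\<^bsub>K\<^esub> \<one>\<^bsub>K\<^esub>) \<odot>\<^bsub>V\<^esub> x = \<ominus>\<^bsub>V\<^esub> x"
  by (simp add: smult_l_minus)

lemma (in normed_vectorspace) metric: "Metric_space (carrier X) (ndist X)"
proof
  have minus: "vnorm X (x \<ominus>\<^bsub>X\<^esub> y) = vnorm X (y \<ominus>\<^bsub>X\<^esub> x)"
    if "x \<in> carrier X" "y \<in> carrier X" for x y
  proof -
    have "y \<ominus>\<^bsub>X\<^esub> x = \<ominus>\<^bsub>X\<^esub> (x \<ominus>\<^bsub>X\<^esub> y)"
      using that by (simp add: a_minus_def M.minus_add M.a_comm)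
    also have "\<dots> = (- 1) \<odot>\<^bsub>X\<^esub> (x \<ominus>\<^bsub>X\<^esub> y)"
      using that smult_minus_one[of "x \<ominus>\<^bsub>X\<^esub> y"] by (simp add: class_ring_simps)
    finally show ?thesis
      using that by (simp add: vnorm_smult)
  qed
  fix x y z
  show "0 \<le> ndist X x y"
    by (simp add: ndist_def vnorm_nonneg)
  show "ndist X x y = ndist X y x"
    using minus by (simp add: ndist_def)
  show "ndist X x y = 0 \<longleftrightarrow> x = y" if "x \<in> carrier X" "y \<in> carrier X"
    using that by (simp add: ndist_def vnorm_eq_0_iff)
  show "ndist X x z \<le> ndist X x y + ndist X y z"
    if "x \<in> carrier X" "y \<in> carrier X" "z \<in> carrier X"
  proof -
    have "x \<ominus>\<^bsub>X\<^esub> z = (x \<ominus>\<^bsub>X\<^esub> y) \<oplus>\<^bsub>X\<^esub> (y \<ominus>\<^bsub>X\<^esub> z)"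
      using that by (simp add: a_minus_def M.a_ac M.r_neg2)
    then show ?thesis
      using that vnorm_triangle[of "x \<ominus>\<^bsub>X\<^esub> y" "y \<ominus>\<^bsub>X\<^esub> z"] by (simp add: ndist_def)
  qed
qed

lemma operatorsD:
  assumes "T \<in> operators X Y"
  shows operators_closed: "x \<in> carrier X \<Longrightarrow> T x \<in> carrier Y"
    and operators_add: "x \<in> carrier X \<Longrightarrow> y \<in> carrier X \<Longrightarrow> T (x \<oplus>\<^bsub>X\<^esub> y) = T x \<oplus>\<^bsub>Y\<^esub> T y"
    and operators_smult: "x \<in> carrier X \<Longrightarrow> T (c \<odot>\<^bsub>X\<^esub> x) = c \<odot>\<^bsub>Y\<^esub> T x"
    and operators_hom: "T \<in> module_hom class_ring X Y"
    and operators_extensional: "T \<in> extensional (carrier X)"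
  using assms by (auto simp: operators_def module_hom_def)

lemma restrict_in_operators:
  assumes "homogeneous_norm X"
    and "T \<in> module_hom class_ring X Y"
    and "\<And>x. x \<in> carrier X \<Longrightarrow> vnorm Y (T x) \<le> M * vnorm X x"
  shows "restrict T (carrier X) \<in> operators X Y"
proof -
  interpret X: homogeneous_norm X by fact
  have "restrict T (carrier X) \<in> module_hom class_ring X Y"
    using assms(2) by (auto simp: module_hom_def)
  then show ?thesis
    using assms(3) by (auto simp: operators_def intro!: exI[of _ M])
qed

lemma operators_bound_pos:
  assumes "homogeneous_norm X" and "T \<in> operators X Y"
  obtains M where "1 \<le> M" "\<And>x. x \<in> carrier X \<Longrightarrow> vnorm Y (T x) \<le> M * vnorm X x"
proof -
  interpret X: homogeneous_norm X by fact
  obtain M where M: "\<And>x. x \<in> carrier X \<Longrightarrow> vnorm Y (T x) \<le> M * vnorm X x"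
    using assms(2) by (auto simp: operators_def)
  have "vnorm Y (T x) \<le> max 1 M * vnorm X x" if "x \<in> carrier X" for x
    using M[OF that] X.vnorm_nonneg[OF that] mult_right_mono[of M "max 1 M" "vnorm X x"] by simp
  then show ?thesis
    using that[of "max 1 M"] by simp
qed

lemma op_norm_bdd:
  assumes "homogeneous_norm X" and "T \<in> operators X Y"
  shows "bdd_above ((\<lambda>x. vnorm Y (T x)) ` {x \<in> carrier X. vnorm X x \<le> 1})"
proof -
  obtain M where M: "1 \<le> M" "\<And>x. x \<in> carrier X \<Longrightarrow> vnorm Y (T x) \<le> M * vnorm X x"
    using operators_bound_pos[OF assms] by blast
  have "vnorm Y (T x) \<le> M" if "x \<in> carrier X" "vnorm X x \<le> 1" for x
    using M(2)[OF that(1)] mult_left_mono[OF that(2), of M] M(1) by linarith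
  then show ?thesis
    by (auto intro!: bdd_aboveI2)
qed

text \<open>
  Rescaling \<open>x\<close> to a unit vector reduces the estimate to the definition of the supremum.
\<close>

lemma op_norm_bound:
  fixes X :: "('k::real_normed_field, 'a) normed_space"
  assumes "homogeneous_norm X" and "homogeneous_norm Y" and T: "T \<in> operators X Y"
    and x: "x \<in> carrier X"
  shows "vnorm Y (T x) \<le> op_norm X Y T * vnorm X x"
proof -
  interpret X: homogeneous_norm X by fact
  interpret Y: homogeneous_norm Y by fact
  show ?thesis
  proof (cases "vnorm X x = 0")
    case True
    obtain M where "vnorm Y (T x) \<le> M * vnorm X x"
      using operators_bound_pos[OF assms(1,3)] x by metis
    with True show ?thesis by simp
  next
    case False
    define c :: 'k where "c = of_real (1 / vnorm X x)"
    have pos: "0 < vnorm X x"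
      using False X.vnorm_nonneg[OF x] by simp
    then have c: "norm c = 1 / vnorm X x"
      by (simp add: c_def norm_divide)
    have cx: "c \<odot>\<^bsub>X\<^esub> x \<in> carrier X" "vnorm X (c \<odot>\<^bsub>X\<^esub> x) \<le> 1"
      using x pos by (simp_all add: X.vnorm_smult c)
    have "vnorm Y (T (c \<odot>\<^bsub>X\<^esub> x)) \<le> op_norm X Y T"
      unfolding op_norm_def using cx
      by (intro cSUP_upper op_norm_bdd[OF assms(1) T]) auto
    then have "vnorm Y (T x) / vnorm X x \<le> op_norm X Y T"
      using x by (simp add: operators_smult[OF T] operators_closed[OF T] Y.vnorm_smult c)
    then show ?thesis
      using pos by (simp add: field_simps)
  qed
qed

lemma op_norm_le:
  assumes "homogeneous_norm X" and "0 \<le> M"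
    and "\<And>x. x \<in> carrier X \<Longrightarrow> vnorm Y (T x) \<le> M * vnorm X x"
  shows "op_norm X Y T \<le> M"
proof -
  interpret X: homogeneous_norm X by fact
  have "\<zero>\<^bsub>X\<^esub> \<in> {x \<in> carrier X. vnorm X x \<le> 1}"
    by (simp add: X.vnorm_zero)
  moreover have "vnorm Y (T x) \<le> M" if "x \<in> carrier X" "vnorm X x \<le> 1" for x
    using assms(3)[OF that(1)] mult_left_mono[OF that(2) assms(2)] by simp
  ultimately show ?thesis
    unfolding op_norm_def by (intro cSUP_least) auto
qed

lemma op_norm_nonneg:
  assumes "homogeneous_norm X" and "homogeneous_norm Y" and T: "T \<in> operators X Y"
  shows "0 \<le> op_norm X Y T"
proof -
  interpret X: homogeneous_norm X by fact
  interpret Y: homogeneous_norm Y by fact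
  have "vnorm Y (T \<zero>\<^bsub>X\<^esub>) \<le> op_norm X Y T"
    unfolding op_norm_def
    by (intro cSUP_upper op_norm_bdd[OF assms(1) T]) (simp add: X.vnorm_zero)
  moreover have "0 \<le> vnorm Y (T \<zero>\<^bsub>X\<^esub>)"
    by (simp add: Y.vnorm_nonneg operators_closed[OF T])
  ultimately show ?thesis by simp
qed

lemma op_space_simps:
  "carrier (op_space X Y) = operators X Y"
  "\<zero>\<^bsub>op_space X Y\<^esub> = (\<lambda>x\<in>carrier X. \<zero>\<^bsub>Y\<^esub>)"
  "S \<oplus>\<^bsub>op_space X Y\<^esub> T = (\<lambda>x\<in>carrier X. S x \<oplus>\<^bsub>Y\<^esub> T x)"
  "c \<odot>\<^bsub>op_space X Y\<^esub> T = (\<lambda>x\<in>carrier X. c \<odot>\<^bsub>Y\<^esub> T x)"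
  "vnorm (op_space X Y) = op_norm X Y"
  by (simp_all add: op_space_def)

lemma operators_eqI:
  assumes "S \<in> operators X Y" and "T \<in> operators X Y"
    and "\<And>x. x \<in> carrier X \<Longrightarrow> S x = T x"
  shows "S = T"
  using assms by (blast intro: extensionalityI operators_extensional)

text \<open>
  The vector space and norm axioms are inherited pointwise from \<open>Y\<close>. The bound
  \<open>\<parallel>c T\<parallel> \<le> |c| \<parallel>T\<parallel>\<close>, applied also to \<open>1 / c\<close> and \<open>c T\<close> when \<open>c \<noteq> 0\<close>, gives homogeneity.
\<close>

lemma normed_vectorspace_op_space:
  fixes X :: "('k::real_normed_field, 'a) normed_space"
  assumes "normed_vectorspace X" and "normed_vectorspace Y"
  shows "normed_vectorspace (op_space X Y)"
proof -
  interpret X: normed_vectorspace X by fact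
  interpret Y: normed_vectorspace Y by fact
  note hX = X.homogeneous_norm and hY = Y.homogeneous_norm
  have zero: "(\<lambda>x\<in>carrier X. \<zero>\<^bsub>Y\<^esub>) \<in> operators X Y"
    using X.vnorm_nonneg
    by (intro restrict_in_operators[OF hX, where M = 0])
      (auto simp: module_hom_def homogeneous_norm.vnorm_zero[OF hY])
  have smult: "(\<lambda>x\<in>carrier X. c \<odot>\<^bsub>Y\<^esub> T x) \<in> operators X Y" if T: "T \<in> operators X Y" for c T
  proof (rule restrict_in_operators[OF hX])
    have "c \<odot>\<^bsub>Y\<^esub> (d \<odot>\<^bsub>Y\<^esub> y) = d \<odot>\<^bsub>Y\<^esub> (c \<odot>\<^bsub>Y\<^esub> y)" if "y \<in> carrier Y" for d y
      using that Y.smult_assoc1[of c d y] Y.smult_assoc1[of d c y] by (simp add: mult.commute)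
    then show "(\<lambda>x. c \<odot>\<^bsub>Y\<^esub> T x) \<in> module_hom class_ring X Y"
      by (auto simp: module_hom_def operators_closed[OF T] operators_add[OF T]
          operators_smult[OF T] Y.smult_r_distr)
    show "vnorm Y (c \<odot>\<^bsub>Y\<^esub> T x) \<le> (norm c * op_norm X Y T) * vnorm X x" if "x \<in> carrier X" for x
      using mult_left_mono[OF op_norm_bound[OF hX hY T that], of "norm c"]
      by (simp add: Y.vnorm_smult operators_closed[OF T that] mult.assoc)
  qed
  have add_bound: "vnorm Y (S x \<oplus>\<^bsub>Y\<^esub> T x) \<le> (op_norm X Y S + op_norm X Y T) * vnorm X x"
    if S: "S \<in> operators X Y" and T: "T \<in> operators X Y" and x: "x \<in> carrier X" for S T x
    using Y.vnorm_triangle[OF operators_closed[OF S x] operators_closed[OF T x]]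
      op_norm_bound[OF hX hY S x] op_norm_bound[OF hX hY T x]
    by (simp add: algebra_simps)
  have add: "(\<lambda>x\<in>carrier X. S x \<oplus>\<^bsub>Y\<^esub> T x) \<in> operators X Y"
    if S: "S \<in> operators X Y" and T: "T \<in> operators X Y" for S T
  proof (rule restrict_in_operators[OF hX _ add_bound[OF S T]])
    show "(\<lambda>x. S x \<oplus>\<^bsub>Y\<^esub> T x) \<in> module_hom class_ring X Y"
      by (auto simp: module_hom_def operators_closed[OF S] operators_closed[OF T]
          operators_add[OF S] operators_add[OF T]
          operators_smult[OF S] operators_smult[OF T] Y.smult_r_distr Y.M.a_ac)
  qed
  have inverse: "\<exists>S\<in>operators X Y. (\<lambda>x\<in>carrier X. S x \<oplus>\<^bsub>Y\<^esub> T x) = (\<lambda>x\<in>carrier X. \<zero>\<^bsub>Y\<^esub>)"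
    if T: "T \<in> operators X Y" for T
  proof (rule bexI[OF _ smult[OF T, of "- 1"]])
    have "(- 1) \<odot>\<^bsub>Y\<^esub> y \<oplus>\<^bsub>Y\<^esub> y = \<zero>\<^bsub>Y\<^esub>" if "y \<in> carrier Y" for y
      using that Y.smult_minus_one[of y] by (simp add: class_ring_simps Y.M.l_neg)
    then show "(\<lambda>x\<in>carrier X. (\<lambda>x\<in>carrier X. (- 1) \<odot>\<^bsub>Y\<^esub> T x) x \<oplus>\<^bsub>Y\<^esub> T x) = (\<lambda>x\<in>carrier X. \<zero>\<^bsub>Y\<^esub>)"
      by (auto simp: operators_closed[OF T] intro!: restrict_ext)
  qed
  have closed: "T x \<in> carrier Y" if "T \<in> operators X Y" "x \<in> carrier X" for T x
    using that by (rule operators_closed)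
  have group: "abelian_group (op_space X Y)"
  proof (rule abelian_groupI, unfold op_space_simps)
    fix R S T assume ops: "R \<in> operators X Y" "S \<in> operators X Y" "T \<in> operators X Y"
    show "(\<lambda>x\<in>carrier X. (\<lambda>x\<in>carrier X. R x \<oplus>\<^bsub>Y\<^esub> S x) x \<oplus>\<^bsub>Y\<^esub> T x)
        = (\<lambda>x\<in>carrier X. R x \<oplus>\<^bsub>Y\<^esub> (\<lambda>x\<in>carrier X. S x \<oplus>\<^bsub>Y\<^esub> T x) x)"
      by (rule restrict_ext) (simp add: closed ops Y.M.a_assoc)
  next
    fix S T assume ops: "S \<in> operators X Y" "T \<in> operators X Y"
    show "(\<lambda>x\<in>carrier X. S x \<oplus>\<^bsub>Y\<^esub> T x) = (\<lambda>x\<in>carrier X. T x \<oplus>\<^bsub>Y\<^esub> S x)"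
      by (rule restrict_ext) (simp add: closed ops Y.M.a_comm)
  next
    fix T assume T: "T \<in> operators X Y"
    show "(\<lambda>x\<in>carrier X. (\<lambda>x\<in>carrier X. \<zero>\<^bsub>Y\<^esub>) x \<oplus>\<^bsub>Y\<^esub> T x) = T"
      by (rule operators_eqI[OF add[OF zero T] T]) (simp add: closed T)
  qed (fact add zero inverse)+
  show ?thesis
  proof (intro normed_vectorspace.intro vectorspace.intro normed_vectorspace_axioms.intro)
    show "module class_ring (op_space X Y)"
    proof (rule moduleI, rule class_cring.is_cring, rule group, unfold op_space_simps)
      fix S T and c d :: 'k assume ops: "S \<in> operators X Y" "T \<in> operators X Y"
      show "(\<lambda>x\<in>carrier X. c \<odot>\<^bsub>Y\<^esub> T x) \<in> operators X Y"
        using smult ops by simp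
      show "(\<lambda>x\<in>carrier X. (c \<oplus>\<^bsub>class_ring\<^esub> d) \<odot>\<^bsub>Y\<^esub> T x)
          = (\<lambda>x\<in>carrier X. (\<lambda>x\<in>carrier X. c \<odot>\<^bsub>Y\<^esub> T x) x \<oplus>\<^bsub>Y\<^esub> (\<lambda>x\<in>carrier X. d \<odot>\<^bsub>Y\<^esub> T x) x)"
        by (rule restrict_ext) (use Y.smult_l_distr in \<open>simp add: closed ops\<close>)
      show "(\<lambda>x\<in>carrier X. c \<odot>\<^bsub>Y\<^esub> (\<lambda>x\<in>carrier X. S x \<oplus>\<^bsub>Y\<^esub> T x) x)
          = (\<lambda>x\<in>carrier X. (\<lambda>x\<in>carrier X. c \<odot>\<^bsub>Y\<^esub> S x) x \<oplus>\<^bsub>Y\<^esub> (\<lambda>x\<in>carrier X. c \<odot>\<^bsub>Y\<^esub> T x) x)"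
        by (rule restrict_ext) (simp add: closed ops Y.smult_r_distr)
      show "(\<lambda>x\<in>carrier X. (c \<otimes>\<^bsub>class_ring\<^esub> d) \<odot>\<^bsub>Y\<^esub> T x)
          = (\<lambda>x\<in>carrier X. c \<odot>\<^bsub>Y\<^esub> (\<lambda>x\<in>carrier X. d \<odot>\<^bsub>Y\<^esub> T x) x)"
        by (rule restrict_ext) (use Y.smult_assoc1 in \<open>simp add: closed ops\<close>)
      show "(\<lambda>x\<in>carrier X. \<one>\<^bsub>class_ring\<^esub> \<odot>\<^bsub>Y\<^esub> T x) = T"
        by (rule operators_eqI[OF smult[OF ops(2)] ops(2)])
          (use Y.smult_one in \<open>simp add: closed ops\<close>)
    qed
    show "field (class_ring :: 'k ring)"
      by (rule class_field)
    fix S T c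
    show "0 \<le> vnorm (op_space X Y) T" if "T \<in> carrier (op_space X Y)"
      using that op_norm_nonneg[OF hX hY] by (simp add: op_space_simps)
    show "vnorm (op_space X Y) T = 0 \<longleftrightarrow> T = \<zero>\<^bsub>op_space X Y\<^esub>" if "T \<in> carrier (op_space X Y)"
    proof
      have T: "T \<in> operators X Y"
        using that by (simp add: op_space_simps)
      assume "vnorm (op_space X Y) T = 0"
      then have "vnorm Y (T x) \<le> 0" if "x \<in> carrier X" for x
        using op_norm_bound[OF hX hY T that] by (simp add: op_space_simps)
      then have "T x = \<zero>\<^bsub>Y\<^esub>" if "x \<in> carrier X" for x
        using that Y.vnorm_nonneg Y.vnorm_eq_0_iff operators_closed[OF T]
        by (meson order_antisym)
      then show "T = \<zero>\<^bsub>op_space X Y\<^esub>"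
        unfolding op_space_simps by (intro operators_eqI[OF T zero]) simp
    next
      assume "T = \<zero>\<^bsub>op_space X Y\<^esub>"
      then have "op_norm X Y T \<le> 0"
        by (intro op_norm_le[OF hX])
          (auto simp: op_space_simps homogeneous_norm.vnorm_zero[OF hY])
      then show "vnorm (op_space X Y) T = 0"
        using op_norm_nonneg[OF hX hY, of T] that by (simp add: op_space_simps)
    qed
    show "vnorm (op_space X Y) (c \<odot>\<^bsub>op_space X Y\<^esub> T) = norm c * vnorm (op_space X Y) T"
      if "T \<in> carrier (op_space X Y)"
    proof -
      have T: "T \<in> operators X Y"
        using that by (simp add: op_space_simps)
      have le: "op_norm X Y (\<lambda>x\<in>carrier X. c \<odot>\<^bsub>Y\<^esub> T x) \<le> norm c * op_norm X Y T"
        if T: "T \<in> operators X Y" for c T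
        using op_norm_nonneg[OF hX hY T] mult_left_mono[OF op_norm_bound[OF hX hY T], of _ "norm c"]
        by (intro op_norm_le[OF hX])
          (auto simp: Y.vnorm_smult operators_closed[OF T] mult.assoc)
      have "norm c * op_norm X Y T \<le> op_norm X Y (\<lambda>x\<in>carrier X. c \<odot>\<^bsub>Y\<^esub> T x)"
      proof (cases "c = 0")
        case True
        then show ?thesis
          using op_norm_nonneg[OF hX hY smult[OF T]] by simp
      next
        case False
        then have "(1 / c) \<odot>\<^bsub>Y\<^esub> (c \<odot>\<^bsub>Y\<^esub> y) = y" if "y \<in> carrier Y" for y
          using that Y.smult_assoc1[of "1 / c" c y] Y.smult_one[of y] by simp
        then have "(\<lambda>x\<in>carrier X. (1 / c) \<odot>\<^bsub>Y\<^esub> (\<lambda>x\<in>carrier X. c \<odot>\<^bsub>Y\<^esub> T x) x) = T"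
          by (intro operators_eqI[OF smult[OF smult[OF T]] T]) (simp add: operators_closed[OF T])
        then show ?thesis
          using le[OF smult[OF T], of "1 / c" c] False by (simp add: norm_divide field_simps)
      qed
      then show ?thesis
        unfolding op_space_simps using le[OF T, of c] by linarith
    qed
    show "vnorm (op_space X Y) (S \<oplus>\<^bsub>op_space X Y\<^esub> T)
        \<le> vnorm (op_space X Y) S + vnorm (op_space X Y) T"
      if "S \<in> carrier (op_space X Y)" "T \<in> carrier (op_space X Y)"
    proof -
      have ST: "S \<in> operators X Y" "T \<in> operators X Y"
        using that by (simp_all add: op_space_simps)
      show ?thesis
        unfolding op_space_simps
        using add_bound[OF ST] op_norm_nonneg[OF hX hY] ST
        by (intro op_norm_le[OF hX]) auto
    qed
  qed
qed

section \<open>Fixing copies of a space\<close>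

text \<open>
  Together with \<open>fixes_copyE\<close> this trades the supremum in the operator norm for pointwise bounds,
  and frees a witness from the convention on its values outside the carrier.
\<close>

lemma fixes_copyI:
  assumes "homogeneous_norm E" and "0 \<le> C"
    and "S \<in> module_hom class_ring E X"
    and "\<And>x. x \<in> carrier E \<Longrightarrow> vnorm X (S x) \<le> C * vnorm E x"
    and "\<And>x. x \<in> carrier E \<Longrightarrow> vnorm E x / C \<le> vnorm Y (T (S x))"
  shows "fixes_copy C E X Y T"
  unfolding fixes_copy_def
proof (intro bexI conjI)
  show "restrict S (carrier E) \<in> operators E X"
    by (rule restrict_in_operators[OF assms(1,3,4)])
  show "op_norm E X (restrict S (carrier E)) \<le> C"
    using assms(4) by (intro op_norm_le[OF assms(1,2)]) simp
  show "bounded_below_by (1 / C) E Y (compose (carrier E) T (restrict S (carrier E)))"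
    using assms(5) by (simp add: bounded_below_by_def compose_def)
qed

lemma fixes_copyE:
  assumes "homogeneous_norm E" and "homogeneous_norm X" and "fixes_copy C E X Y T"
  obtains S where "S \<in> operators E X"
    and "\<And>x. x \<in> carrier E \<Longrightarrow> vnorm X (S x) \<le> C * vnorm E x"
    and "\<And>x. x \<in> carrier E \<Longrightarrow> vnorm E x / C \<le> vnorm Y (T (S x))"
proof -
  interpret E: homogeneous_norm E by fact
  obtain S where S: "S \<in> operators E X" "op_norm E X S \<le> C"
    "bounded_below_by (1 / C) E Y (compose (carrier E) T S)"
    using assms(3) by (auto simp: fixes_copy_def)
  show ?thesis
  proof (rule that[OF S(1)])
    fix x assume x: "x \<in> carrier E"
    show "vnorm X (S x) \<le> C * vnorm E x"
      using op_norm_bound[OF assms(1,2) S(1) x] mult_right_mono[OF S(2) E.vnorm_nonneg[OF x]]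
      by simp
    show "vnorm E x / C \<le> vnorm Y (T (S x))"
      using S(3) x by (simp add: bounded_below_by_def compose_def)
  qed
qed

lemma module_hom_comp:
  assumes "R \<in> module_hom K D E" and "S \<in> module_hom K E X"
  shows "(\<lambda>x. S (R x)) \<in> module_hom K D X"
  using assms by (auto simp: module_hom_def Pi_def)

text \<open>
  On the range of the witness \<open>S\<close>, \<open>D\<close> consumes at most half of the lower bound of \<open>T = D + T'\<close>,
  so \<open>S\<close> also serves for \<open>T'\<close>. Both the closedness of the ideal (\<open>D\<close> of small norm) and its
  stability under sums (\<open>D\<close> small on a well-chosen subspace only) rest on this estimate.
\<close>

lemma fixes_copy_perturb:
  assumes "homogeneous_norm E" and "normed_vectorspace Y" and "1 \<le> C"
    and S: "S \<in> module_hom class_ring E X"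
    and bound: "\<And>x. x \<in> carrier E \<Longrightarrow> vnorm X (S x) \<le> C * vnorm E x"
    and below: "\<And>x. x \<in> carrier E \<Longrightarrow> vnorm E x / C \<le> vnorm Y (T (S x))"
    and D: "D \<in> operators X Y" and T': "T' \<in> operators X Y"
    and T: "\<And>x. x \<in> carrier X \<Longrightarrow> T x = D x \<oplus>\<^bsub>Y\<^esub> T' x"
    and small: "\<And>x. x \<in> carrier E \<Longrightarrow> vnorm Y (D (S x)) \<le> vnorm E x / (2 * C)"
  shows "fixes_copy (2 * C) E X Y T'"
proof (rule fixes_copyI[OF assms(1) _ S])
  interpret E: homogeneous_norm E by fact
  interpret Y: normed_vectorspace Y by fact
  show "0 \<le> 2 * C"
    using \<open>1 \<le> C\<close> by simp
  fix x assume x: "x \<in> carrier E"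
  show "vnorm X (S x) \<le> 2 * C * vnorm E x"
  proof -
    have "0 \<le> C * vnorm E x"
      using \<open>1 \<le> C\<close> E.vnorm_nonneg[OF x] by simp
    then show ?thesis
      using bound[OF x] by simp
  qed
  have Sx: "S x \<in> carrier X"
    using S x by (auto simp: module_hom_def)
  have "vnorm E x / C \<le> vnorm E x / (2 * C) + vnorm Y (T' (S x))"
    using below[OF x] small[OF x] T[OF Sx]
      Y.vnorm_triangle[OF operators_closed[OF D Sx] operators_closed[OF T' Sx]] by simp
  then show "vnorm E x / (2 * C) \<le> vnorm Y (T' (S x))"
    by (simp add: field_simps)
qed

text \<open>
  If \<open>S\<close> witnesses that \<open>T'\<close> fixes a copy of \<open>E\<close>, then \<open>R S\<close> is a witness for \<open>T\<close>. The
  domination hypothesis covers both \<open>T' = U T R\<close> and \<open>T' = c T\<close>.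
\<close>

lemma fixes_uniformly_factor:
  assumes "\<And>E. E \<in> F \<Longrightarrow> homogeneous_norm E"
    and "homogeneous_norm W" and "homogeneous_norm Y"
    and R: "R \<in> operators W X" and T: "T \<in> operators X Y" and "0 \<le> M"
    and dominated: "\<And>w. w \<in> carrier W \<Longrightarrow> vnorm Z (T' w) \<le> M * vnorm Y (T (R w))"
    and T'_fixes: "fixes_uniformly F W Z T'"
  shows "fixes_uniformly F X Y T"
proof -
  interpret Y: homogeneous_norm Y by fact
  obtain C where C: "1 \<le> C" "\<And>E. E \<in> F \<Longrightarrow> fixes_copy C E W Z T'"
    using T'_fixes by (auto simp: fixes_uniformly_def)
  obtain r where r: "1 \<le> r" "\<And>w. w \<in> carrier W \<Longrightarrow> vnorm X (R w) \<le> r * vnorm W w"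
    using operators_bound_pos[OF assms(2) R] by blast
  \<comment> \<open>\<open>C'\<close> absorbs the norm of \<open>R\<close> above and the factor \<open>M\<close> below; both are enlarged to at
    least 1 so that one constant dominates both products.\<close>
  define C' where "C' = C * (r * max 1 M)"
  have "1 \<le> r * max 1 M"
    using mult_mono[OF r(1), of 1 "max 1 M"] r(1) by simp
  then have "C \<le> C'"
    using C(1) unfolding C'_def by (simp add: mult_le_cancel_left1)
  have "C * r \<le> C'"
    using C(1) r(1) by (simp add: C'_def mult_le_cancel_left1)
  have "C * max 1 M \<le> C'"
    using C(1) r(1) by (simp add: C'_def mult_le_cancel_right1)
  have "fixes_copy C' E X Y T" if E: "E \<in> F" for E
  proof -
    note hE = assms(1)[OF E]
    interpret E: homogeneous_norm E by (rule hE)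
    obtain S where S: "S \<in> operators E W"
      "\<And>x. x \<in> carrier E \<Longrightarrow> vnorm W (S x) \<le> C * vnorm E x"
      "\<And>x. x \<in> carrier E \<Longrightarrow> vnorm E x / C \<le> vnorm Z (T' (S x))"
      using fixes_copyE[OF hE assms(2) C(2)[OF E]] by blast
    show ?thesis
    proof (rule fixes_copyI[OF hE _ module_hom_comp[OF operators_hom[OF S(1)] operators_hom[OF R]]])
      show "0 \<le> C'"
        using \<open>C \<le> C'\<close> C(1) by simp
      fix x assume x: "x \<in> carrier E"
      note Sx = operators_closed[OF S(1) x]
      have "vnorm X (R (S x)) \<le> r * (C * vnorm E x)"
        using r(2)[OF Sx] mult_left_mono[OF S(2)[OF x], of r] r(1) by linarith
      also have "\<dots> = (C * r) * vnorm E x"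
        by simp
      also have "\<dots> \<le> C' * vnorm E x"
        using \<open>C * r \<le> C'\<close> E.vnorm_nonneg[OF x] by (rule mult_right_mono)
      finally show "vnorm X (R (S x)) \<le> C' * vnorm E x" .
      define y where "y = vnorm Y (T (R (S x)))"
      have "0 \<le> y"
        using Sx by (simp add: y_def Y.vnorm_nonneg operators_closed[OF T] operators_closed[OF R])
      have "vnorm E x / C \<le> M * y"
        using S(3)[OF x] dominated[OF Sx] by (simp add: y_def)
      also have "\<dots> \<le> max 1 M * y"
        using \<open>0 \<le> y\<close> by (simp add: mult_right_mono)
      finally have "vnorm E x \<le> (C * max 1 M) * y"
        using C(1) by (simp add: field_simps)
      also have "\<dots> \<le> C' * y"
        using \<open>C * max 1 M \<le> C'\<close> \<open>0 \<le> y\<close> by (rule mult_right_mono)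
      finally show "vnorm E x / C' \<le> vnorm Y (T (R (S x)))"
        using \<open>C \<le> C'\<close> C(1) by (simp add: y_def field_simps)
    qed
  qed
  then show ?thesis
    using \<open>C \<le> C'\<close> C(1) by (auto simp: fixes_uniformly_def intro!: exI[of _ C'])
qed

text \<open>
  If \<open>T\<close> fixes the family with the constant \<open>C\<close>, then so does every \<open>T'\<close> within \<open>1 / (2C\<^sup>2)\<close> of it,
  with the constant \<open>2C\<close>.
\<close>

lemma closedin_non_fixing:
  assumes hF: "\<And>E. E \<in> F \<Longrightarrow> homogeneous_norm E"
    and "normed_vectorspace X" and "normed_vectorspace Y"
  shows "closedin (Metric_space.mtopology (operators X Y) (ndist (op_space X Y)))
    (non_fixing F X Y)"
proof -
  interpret X: normed_vectorspace X by fact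
  interpret Y: normed_vectorspace Y by fact
  note hX = X.homogeneous_norm and hY = Y.homogeneous_norm
  interpret O: normed_vectorspace "op_space X Y"
    using assms(2,3) by (rule normed_vectorspace_op_space)
  interpret M: Metric_space "operators X Y" "ndist (op_space X Y)"
    using O.metric by (simp add: op_space_simps)
  have "\<exists>r>0. disjnt (non_fixing F X Y) (M.mball T r)"
    if T: "T \<in> operators X Y - non_fixing F X Y" for T
  proof -
    obtain C where C: "1 \<le> C" "\<And>E. E \<in> F \<Longrightarrow> fixes_copy C E X Y T"
      using T by (auto simp: non_fixing_def fixes_uniformly_def)
    \<comment> \<open>A witness \<open>S\<close> has norm at most \<open>C\<close>, so \<open>\<parallel>(T - T') S x\<parallel> \<le> r C \<parallel>x\<parallel>\<close>; this has to be
      at most \<open>\<parallel>x\<parallel> / (2C)\<close>.\<close>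
    define r where "r = 1 / (2 * C * C)"
    have "fixes_uniformly F X Y T'" if T': "T' \<in> M.mball T r" for T'
    proof -
      define D where "D = T \<ominus>\<^bsub>op_space X Y\<^esub> T'"
      have ops: "T \<in> carrier (op_space X Y)" "T' \<in> carrier (op_space X Y)"
        using T' by (auto simp: op_space_simps)
      have D: "D \<in> operators X Y"
        using O.M.minus_closed[OF ops] by (simp add: D_def op_space_simps)
      have norm_D: "op_norm X Y D \<le> r"
        using T' by (auto simp: D_def ndist_def op_space_simps)
      have "T = D \<oplus>\<^bsub>op_space X Y\<^esub> T'"
        using ops by (simp add: D_def a_minus_def O.M.a_assoc O.M.l_neg)
      then have split: "T x = D x \<oplus>\<^bsub>Y\<^esub> T' x" if "x \<in> carrier X" for x
        using that by (simp add: op_space_simps fun_eq_iff)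
      have "fixes_copy (2 * C) E X Y T'" if E: "E \<in> F" for E
      proof -
        note hE = hF[OF E]
        interpret E: homogeneous_norm E by (rule hE)
        obtain S where S: "S \<in> operators E X"
          "\<And>x. x \<in> carrier E \<Longrightarrow> vnorm X (S x) \<le> C * vnorm E x"
          "\<And>x. x \<in> carrier E \<Longrightarrow> vnorm E x / C \<le> vnorm Y (T (S x))"
          using fixes_copyE[OF hE hX C(2)[OF E]] by blast
        show ?thesis
        proof (rule fixes_copy_perturb[OF hE assms(3) C(1) operators_hom[OF S(1)] S(2,3) D _ split])
          show "T' \<in> operators X Y"
            using T' by simp
          fix x assume x: "x \<in> carrier E"
          have "vnorm Y (D (S x)) \<le> op_norm X Y D * vnorm X (S x)"
            by (rule op_norm_bound[OF hX hY D operators_closed[OF S(1) x]])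
          also have "\<dots> \<le> r * (C * vnorm E x)"
            using norm_D S(2)[OF x] op_norm_nonneg[OF hX hY D]
              X.vnorm_nonneg[OF operators_closed[OF S(1) x]] by (intro mult_mono) auto
          also have "\<dots> = vnorm E x / (2 * C)"
            using C(1) by (simp add: r_def)
          finally show "vnorm Y (D (S x)) \<le> vnorm E x / (2 * C)" .
        qed
      qed
      then show ?thesis
        using C(1) by (auto simp: fixes_uniformly_def intro!: exI[of _ "2 * C"])
    qed
    moreover have "0 < r"
      using C(1) by (simp add: r_def)
    ultimately show ?thesis
      by (auto simp: disjnt_def non_fixing_def)
  qed
  then show ?thesis
    unfolding M.closedin_metric by (auto simp: non_fixing_def)
qed

section \<open>The norm of finite-dimensional sequence spaces\<close>

lemma lp_space_simps:
  "carrier (lp_space p n) = carrier_vec n"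
  "\<zero>\<^bsub>lp_space p n\<^esub> = 0\<^sub>v n"
  "x \<oplus>\<^bsub>lp_space p n\<^esub> y = x + y"
  "c \<odot>\<^bsub>lp_space p n\<^esub> x = c \<cdot>\<^sub>v x"
  "vnorm (lp_space p n) = lp_norm p"
  by (simp_all add: lp_space_def module.extend_def module_vec_simps)

lemma vectorspace_lp_space:
  "vectorspace class_ring (lp_space p n :: ('k::real_normed_field, 'k vec) normed_space)"
proof (rule vectorspace.intro)
  have "\<exists>y\<in>carrier_vec n. y + x = 0\<^sub>v n" if "x \<in> carrier_vec n" for x :: "'k vec"
    using that by (intro bexI[of _ "- x"]) auto
  then have "abelian_group (lp_space p n :: ('k, 'k vec) normed_space)"
    by (intro abelian_groupI) (auto simp: lp_space_simps intro: comm_add_vec)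
  then show "module class_ring (lp_space p n :: ('k, 'k vec) normed_space)"
    by (intro moduleI class_cring.is_cring)
      (auto simp: lp_space_simps add_smult_distrib_vec smult_add_distrib_vec)
qed (rule class_field)

lemma lp_norm_infinity_le_iff:
  "0 \<le> M \<Longrightarrow> lp_norm \<infinity> x \<le> M \<longleftrightarrow> (\<forall>i<dim_vec x. norm (x $ i) \<le> M)"
  by (auto simp: lp_norm_def)

lemma lp_norm_nonneg: "0 \<le> lp_norm p x"
  by (simp add: lp_norm_def Max_ge_iff)

lemma enn2real_pos:
  assumes "1 \<le> p" and "p \<noteq> \<infinity>"
  shows "0 < enn2real p"
  using assms by (simp add: enn2real_positive_iff less_top order_less_le_trans[of 0 1])

lemma norm_index_le_lp_norm:
  assumes "1 \<le> p" and "i < dim_vec x"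
  shows "norm (x $ i) \<le> lp_norm p x"
proof (cases "p = \<infinity>")
  case True
  then show ?thesis
    by (metis True assms(2) lp_norm_infinity_le_iff lp_norm_nonneg order_refl)
next
  case False
  define r where "r = enn2real p"
  have "0 < r"
    using enn2real_pos[OF assms(1) False] by (simp add: r_def)
  have "norm (x $ i) powr r \<le> (\<Sum>i<dim_vec x. norm (x $ i) powr r)"
    using assms(2) by (intro member_le_sum) auto
  then have "(norm (x $ i) powr r) powr (1 / r) \<le> (\<Sum>i<dim_vec x. norm (x $ i) powr r) powr (1 / r)"
    using \<open>0 < r\<close> by (intro powr_mono2) auto
  then show ?thesis
    using \<open>0 < r\<close> False by (simp add: lp_norm_def r_def powr_powr)
qed

lemma lp_norm_smult:
  assumes "1 \<le> p"
  shows "lp_norm p (c \<cdot>\<^sub>v x) = norm c * lp_norm p x"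
proof (cases "p = \<infinity>")
  case True
  have "mono ((*) (norm c))"
    by (simp add: monoI mult_left_mono)
  then have "norm c * Max (insert 0 ((\<lambda>i. norm (x $ i)) ` {..<dim_vec x}))
      = Max ((*) (norm c) ` insert 0 ((\<lambda>i. norm (x $ i)) ` {..<dim_vec x}))"
    by (rule mono_Max_commute) auto
  also have "(*) (norm c) ` insert 0 ((\<lambda>i. norm (x $ i)) ` {..<dim_vec x})
      = insert 0 ((\<lambda>i. norm ((c \<cdot>\<^sub>v x) $ i)) ` {..<dim_vec x})"
    by (force simp: norm_mult)
  finally show ?thesis
    using True by (simp add: lp_norm_def)
next
  case False
  define r where "r = enn2real p"
  have "0 < r"
    using enn2real_pos[OF assms(1) False] by (simp add: r_def)
  have "(\<Sum>i<dim_vec x. norm ((c \<cdot>\<^sub>v x) $ i) powr r) = norm c powr r * (\<Sum>i<dim_vec x. norm (x $ i) powr r)"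
    unfolding sum_distrib_left by (rule sum.cong) (auto simp: norm_mult powr_mult)
  then show ?thesis
    using \<open>0 < r\<close> False by (simp add: lp_norm_def r_def powr_mult powr_powr sum_nonneg)
qed

lemma homogeneous_norm_lp_space:
  assumes "1 \<le> p"
  shows "homogeneous_norm (lp_space p n :: ('k::real_normed_field, 'k vec) normed_space)"
proof (intro homogeneous_norm.intro vectorspace_lp_space homogeneous_norm_axioms.intro;
    unfold lp_space_simps)
  fix x :: "'k vec" assume x: "x \<in> carrier_vec n"
  show "lp_norm p x = 0 \<longleftrightarrow> x = 0\<^sub>v n"
  proof
    assume "lp_norm p x = 0"
    then have "norm (x $ i) \<le> 0" if "i < n" for i
      using norm_index_le_lp_norm[OF assms, of i x] x that by simp
    then show "x = 0\<^sub>v n"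
      using x by auto
  next
    assume "x = 0\<^sub>v n"
    then have "x = 0 \<cdot>\<^sub>v x"
      by auto
    then show "lp_norm p x = 0"
      using lp_norm_smult[OF assms, of 0 x] by simp
  qed
qed (simp_all add: lp_norm_nonneg lp_norm_smult[OF assms])

lemma lp_norm_cong:
  assumes "dim_vec x = dim_vec y" and "\<And>i. i < dim_vec y \<Longrightarrow> norm (x $ i) = norm (y $ i)"
  shows "lp_norm p x = lp_norm p y"
proof -
  have "(\<lambda>i. norm (x $ i)) ` {..<dim_vec y} = (\<lambda>i. norm (y $ i)) ` {..<dim_vec y}"
    using assms(2) by (intro image_cong) auto
  then show ?thesis
    using assms by (simp add: lp_norm_def)
qed

lemma lp_norm_single:
  fixes c :: "'k::real_normed_field"
  assumes "1 \<le> p" and "j < n"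
  shows "lp_norm p (vec n (\<lambda>i. if i = j then c else 0)) = norm c"
proof -
  let ?x = "vec n (\<lambda>i. if i = j then c else 0)"
  have "lp_norm p ?x \<le> norm c"
  proof (cases "p = \<infinity>")
    case True
    \<comment> \<open>Unfolding \<open>\<infinity>\<close> to \<open>top\<close> would hide the left-hand side of the lemma from the simplifier.\<close>
    then show ?thesis
      by (simp add: lp_norm_infinity_le_iff del: infinity_ennreal_def)
  next
    case False
    define r where "r = enn2real p"
    have "0 < r"
      using enn2real_pos[OF assms(1) False] by (simp add: r_def)
    have "(\<Sum>i<n. norm (?x $ i) powr r) = (\<Sum>i<n. if i = j then norm c powr r else 0)"
      by (rule sum.cong) auto
    then show ?thesis
      using \<open>0 < r\<close> assms(2) False by (simp add: lp_norm_def r_def powr_powr)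
  qed
  moreover have "norm c \<le> lp_norm p ?x"
    using norm_index_le_lp_norm[OF assms(1), of j ?x] assms(2) by simp
  ultimately show ?thesis
    by simp
qed

section \<open>Vectors cut into blocks\<close>

text \<open>
  The concatenation of the \<open>n\<close> vectors \<open>w 0, \<dots>, w (n - 1)\<close> of length \<open>m\<close>.
\<close>

definition blocks :: "nat \<Rightarrow> nat \<Rightarrow> (nat \<Rightarrow> 'a vec) \<Rightarrow> 'a vec" where
  "blocks n m w = vec (n * m) (\<lambda>i. w (i div m) $ (i mod m))"

lemma blocks_carrier: "blocks n m w \<in> carrier_vec (n * m)"
  by (simp add: blocks_def)

lemma div_less_blocks: "i < n * m \<Longrightarrow> i div m < n" for i n m :: nat
  by (simp add: less_mult_imp_div_less)

lemma mod_less_blocks: "i < n * m \<Longrightarrow> i mod m < m" for i n m :: nat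
  by (cases "m = 0") auto

lemma blocks_cong: "(\<And>j. j < n \<Longrightarrow> v j = w j) \<Longrightarrow> blocks n m v = blocks n m w"
  by (auto simp: blocks_def div_less_blocks)

lemma blocks_add:
  assumes "\<And>j. j < n \<Longrightarrow> v j \<in> carrier_vec m" and "\<And>j. j < n \<Longrightarrow> w j \<in> carrier_vec m"
  shows "blocks n m (\<lambda>j. v j + w j) = blocks n m v + blocks n m w"
  using carrier_vecD[OF assms(2)] by (auto simp: blocks_def div_less_blocks mod_less_blocks)

lemma blocks_smult:
  assumes "\<And>j. j < n \<Longrightarrow> w j \<in> carrier_vec m"
  shows "blocks n m (\<lambda>j. c \<cdot>\<^sub>v w j) = c \<cdot>\<^sub>v blocks n m w"
  using carrier_vecD[OF assms] by (auto simp: blocks_def div_less_blocks mod_less_blocks)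

text \<open>
  The identity \<open>\<ell>\<^sub>p\<^sup>n(\<ell>\<^sub>p\<^sup>m) = \<ell>\<^sub>p\<^bsup>nm\<^esup>\<close>. It makes each block an isometric copy of
  \<open>\<ell>\<^sub>p\<^sup>m\<close>, and the span of one unit vector from each block an isometric copy of \<open>\<ell>\<^sub>p\<^sup>n\<close>.
\<close>

lemma lp_norm_blocks:
  fixes w :: "nat \<Rightarrow> 'k::real_normed_field vec"
  assumes "1 \<le> p" and w: "\<And>j. j < n \<Longrightarrow> w j \<in> carrier_vec m"
  shows "lp_norm p (blocks n m w) = lp_norm p (vec n (\<lambda>j. lp_norm p (w j)))"
proof (cases "p = \<infinity>")
  case True
  \<comment> \<open>Both sides have the same upper bounds, which avoids manipulating nested maxima.\<close>
  have "lp_norm \<infinity> (blocks n m w) \<le> M \<longleftrightarrow> lp_norm \<infinity> (vec n (\<lambda>j. lp_norm \<infinity> (w j))) \<le> M"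
    if "0 \<le> M" for M
  proof -
    have "lp_norm \<infinity> (blocks n m w) \<le> M \<longleftrightarrow> (\<forall>i<n * m. norm (w (i div m) $ (i mod m)) \<le> M)"
      using that by (simp add: lp_norm_infinity_le_iff blocks_def del: infinity_ennreal_def)
    also have "\<dots> \<longleftrightarrow> (\<forall>j<n. \<forall>k<m. norm (w j $ k) \<le> M)"
    proof (intro iffI allI impI)
      fix j k assume *: "\<forall>i<n * m. norm (w (i div m) $ (i mod m)) \<le> M" "j < n" "k < m"
      have "j * m + k < Suc j * m"
        using \<open>k < m\<close> by simp
      also have "\<dots> \<le> n * m"
        using \<open>j < n\<close> by (intro mult_le_mono1) simp
      finally show "norm (w j $ k) \<le> M"
        using *(1,3) by (auto dest!: spec[of _ "j * m + k"])
    qed (simp add: div_less_blocks mod_less_blocks)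
    also have "\<dots> \<longleftrightarrow> lp_norm \<infinity> (vec n (\<lambda>j. lp_norm \<infinity> (w j))) \<le> M"
      using that carrier_vecD[OF w] by (simp add: lp_norm_infinity_le_iff lp_norm_nonneg del: infinity_ennreal_def)
    finally show ?thesis .
  qed
  then show ?thesis
    unfolding True by (meson lp_norm_nonneg order_antisym order_refl)
next
  case False
  define r where "r = enn2real p"
  have "0 < r"
    using enn2real_pos[OF assms(1) False] by (simp add: r_def)
  let ?f = "\<lambda>i. norm (w (i div m) $ (i mod m)) powr r"
  have "(\<Sum>i<n * m. ?f i) = (\<Sum>j<n. sum ?f {j * m..<j * m + m})"
    by (rule sum.nat_group[symmetric])
  also have "\<dots> = (\<Sum>j<n. \<Sum>k<m. norm (w j $ k) powr r)"
  proof (rule sum.cong)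
    fix j
    have "sum ?f {0 + j * m..<m + j * m} = (\<Sum>k=0..<m. ?f (k + j * m))"
      by (rule sum.shift_bounds_nat_ivl)
    also have "\<dots> = (\<Sum>k<m. norm (w j $ k) powr r)"
      by (rule sum.cong) auto
    finally show "sum ?f {j * m..<j * m + m} = (\<Sum>k<m. norm (w j $ k) powr r)"
      by (simp add: add.commute)
  qed simp
  also have "\<dots> = (\<Sum>j<n. norm (lp_norm p (w j)) powr r)"
    using \<open>0 < r\<close> False carrier_vecD[OF w]
    by (intro sum.cong) (simp_all add: lp_norm_nonneg, simp_all add: lp_norm_def r_def powr_powr sum_nonneg)
  finally have "(\<Sum>i<n * m. ?f i) = (\<Sum>j<n. norm (lp_norm p (w j)) powr r)" .
  moreover have "lp_norm p (blocks n m w) = (\<Sum>i<n * m. ?f i) powr (1 / r)"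
    using False by (simp add: lp_norm_def blocks_def r_def)
  moreover have "lp_norm p (vec n (\<lambda>j. lp_norm p (w j)))
      = (\<Sum>j<n. norm (lp_norm p (w j)) powr r) powr (1 / r)"
    using False by (simp add: lp_norm_def[of p "vec n _"] r_def)
  ultimately show ?thesis
    by simp
qed

text \<open>
  Subadditivity for \<open>n\<close> summands, by adding the blocks one at a time. Stating it for a subadditive
  function on coordinate vectors keeps finite sums out of the target space.
\<close>

lemma blocks_triangle:
  fixes q :: "'k::real_normed_field vec \<Rightarrow> real"
  assumes "q (0\<^sub>v (n * m)) \<le> 0"
    and "\<And>x y. x \<in> carrier_vec (n * m) \<Longrightarrow> y \<in> carrier_vec (n * m) \<Longrightarrow> q (x + y) \<le> q x + q y"
    and w: "\<And>j. j < n \<Longrightarrow> w j \<in> carrier_vec m"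
  shows "q (blocks n m w) \<le> (\<Sum>j<n. q (blocks n m (\<lambda>i. if i = j then w i else 0\<^sub>v m)))"
proof -
  have "q (blocks n m (\<lambda>i. if i < k then w i else 0\<^sub>v m))
      \<le> (\<Sum>j<k. q (blocks n m (\<lambda>i. if i = j then w i else 0\<^sub>v m)))" if "k \<le> n" for k
    using that
  proof (induction k)
    case 0
    have "blocks n m (\<lambda>i. 0\<^sub>v m) = (0\<^sub>v (n * m) :: 'k vec)"
      by (auto simp: blocks_def mod_less_blocks)
    then show ?case
      using assms(1) by simp
  next
    case (Suc k)
    have "blocks n m (\<lambda>i. if i < Suc k then w i else 0\<^sub>v m)
        = blocks n m (\<lambda>i. (if i < k then w i else 0\<^sub>v m) + (if i = k then w i else 0\<^sub>v m))"
      using w by (intro blocks_cong) auto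
    also have "\<dots> = blocks n m (\<lambda>i. if i < k then w i else 0\<^sub>v m)
        + blocks n m (\<lambda>i. if i = k then w i else 0\<^sub>v m)"
      using w by (intro blocks_add) auto
    finally show ?case
      using Suc assms(2)[OF blocks_carrier blocks_carrier,
          of "\<lambda>i. if i < k then w i else 0\<^sub>v m" "\<lambda>i. if i = k then w i else 0\<^sub>v m"]
      by simp
  qed
  from this[of n] show ?thesis
    using blocks_cong[where v = "\<lambda>i. if i < n then w i else 0\<^sub>v m" and w = w and n = n and m = m]
    by simp
qed

section \<open>Sums of non-fixing operators\<close>

lemma fixes_uniformly_lp_family:
  "fixes_uniformly (lp_family p) X Y T \<longleftrightarrow> (\<exists>C\<ge>1. \<forall>n\<ge>1. fixes_copy C (lp_space p n) X Y T)"
  by (auto simp: fixes_uniformly_def lp_family_def)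

text \<open>
  The crux. The constant \<open>B = 2nC\<close> with which \<open>T\<^sub>1\<close> is defeated grows with \<open>n\<close>, but this affects only
  the length \<open>m\<close> of the blocks and not the constant obtained for \<open>T\<^sub>2\<close>.
\<close>

lemma fixes_uniformly_lp_summand:
  fixes X :: "('k::real_normed_field, 'a) normed_space"
  assumes p: "1 \<le> p" and "normed_vectorspace X" and "normed_vectorspace Y"
    and T\<^sub>1: "T\<^sub>1 \<in> operators X Y" and T\<^sub>2: "T\<^sub>2 \<in> operators X Y"
    and T: "\<And>x. x \<in> carrier X \<Longrightarrow> T x = T\<^sub>1 x \<oplus>\<^bsub>Y\<^esub> T\<^sub>2 x"
    and fixes_sum: "fixes_uniformly (lp_family p) X Y T"
    and not_fixes: "\<not> fixes_uniformly (lp_family p) X Y T\<^sub>1"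
  shows "fixes_uniformly (lp_family p) X Y T\<^sub>2"
proof -
  interpret X: normed_vectorspace X by fact
  interpret Y: normed_vectorspace Y by fact
  note hX = X.homogeneous_norm and hY = Y.homogeneous_norm
  note hE = homogeneous_norm_lp_space[OF p]
  obtain C where C: "1 \<le> C" "\<And>n. 1 \<le> n \<Longrightarrow> fixes_copy C (lp_space p n) X Y T"
    using fixes_sum by (auto simp: fixes_uniformly_lp_family)
  have "fixes_copy (2 * C) (lp_space p n) X Y T\<^sub>2" if "1 \<le> n" for n
  proof -
    define B where "B = 2 * real n * C"
    have "C \<le> B"
      using \<open>1 \<le> n\<close> C(1) by (simp add: B_def mult_le_cancel_right1)
    then obtain m where m: "1 \<le> m" "\<not> fixes_copy B (lp_space p m) X Y T\<^sub>1"
      using not_fixes C(1) unfolding fixes_uniformly_lp_family by (meson order_trans)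
    have "1 \<le> n * m"
      using \<open>1 \<le> n\<close> m(1) by simp
    then obtain S where S: "S \<in> operators (lp_space p (n * m)) X"
      "\<And>x. x \<in> carrier_vec (n * m) \<Longrightarrow> vnorm X (S x) \<le> C * lp_norm p x"
      "\<And>x. x \<in> carrier_vec (n * m) \<Longrightarrow> lp_norm p x / C \<le> vnorm Y (T (S x))"
      using fixes_copyE[OF hE hX C(2)] unfolding lp_space_simps by metis
    \<comment> \<open>The seminorm that \<open>T\<^sub>1\<close> induces on \<open>\<ell>\<^sub>p\<^bsup>nm\<^esup>\<close>.\<close>
    define q where "q x = vnorm Y (T\<^sub>1 (S x))" for x
    have S_closed: "S x \<in> carrier X" if "x \<in> carrier_vec (n * m)" for x
      using operators_closed[OF S(1)] that by (simp add: lp_space_simps)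
    have T\<^sub>1S_closed: "T\<^sub>1 (S x) \<in> carrier Y" if "x \<in> carrier_vec (n * m)" for x
      using operators_closed[OF T\<^sub>1] S_closed that by simp
    have q_nonneg: "0 \<le> q x" if "x \<in> carrier_vec (n * m)" for x
      using that by (simp add: q_def Y.vnorm_nonneg T\<^sub>1S_closed)
    have q_smult: "q (c \<cdot>\<^sub>v x) = norm c * q x" if "x \<in> carrier_vec (n * m)" for c x
      using operators_smult[OF S(1), of x c] that
      by (simp add: q_def lp_space_simps operators_smult[OF T\<^sub>1] S_closed T\<^sub>1S_closed Y.vnorm_smult)
    have q_add: "q (x + y) \<le> q x + q y"
      if "x \<in> carrier_vec (n * m)" "y \<in> carrier_vec (n * m)" for x y
      using operators_add[OF S(1), of x y] that
      by (simp add: q_def lp_space_simps operators_add[OF T\<^sub>1] S_closed T\<^sub>1S_closed Y.vnorm_triangle)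
    \<comment> \<open>The isometric embedding of \<open>\<ell>\<^sub>p\<^sup>m\<close> onto the \<open>j\<close>-th block.\<close>
    define J where "J j w = blocks n m (\<lambda>i. if i = j then w else 0\<^sub>v m)" for j and w :: "'k vec"
    have J_closed: "J j w \<in> carrier_vec (n * m)" for j w
      by (simp add: J_def blocks_carrier)
    have J_smult: "J j (c \<cdot>\<^sub>v w) = c \<cdot>\<^sub>v J j w" if "w \<in> carrier_vec m" for j c w
      unfolding J_def using that by (subst blocks_smult[symmetric]) (auto intro!: blocks_cong eq_vecI)
    have J_add: "J j (v + w) = J j v + J j w" if "v \<in> carrier_vec m" "w \<in> carrier_vec m" for j v w
      unfolding J_def using that by (subst blocks_add[symmetric]) (auto intro!: blocks_cong)
    have J_hom: "J j \<in> module_hom class_ring (lp_space p m) (lp_space p (n * m))" for j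
      by (simp add: module_hom_def lp_space_simps J_closed J_smult J_add)
    have J_norm: "lp_norm p (J j w) = lp_norm p w" if "j < n" "w \<in> carrier_vec m" for j w
    proof -
      have "lp_norm p (0\<^sub>v m :: 'k vec) = 0"
        using homogeneous_norm.vnorm_zero[OF hE, of m] by (simp add: lp_space_simps)
      then have "vec n (\<lambda>i. lp_norm p (if i = j then w else 0\<^sub>v m))
          = vec n (\<lambda>i. if i = j then lp_norm p w else 0)"
        by auto
      then show ?thesis
        using that by (simp add: J_def lp_norm_blocks[OF p] lp_norm_single[OF p] lp_norm_nonneg)
    qed
    have "\<exists>u\<in>carrier_vec m. lp_norm p u = 1 \<and> q (J j u) \<le> 1 / B" if j: "j < n" for j
    proof -
      \<comment> \<open>Otherwise \<open>T\<^sub>1\<close> would be bounded below on the block, and \<open>S J\<^sub>j\<close> would show that it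
        \<open>B\<close>-fixes a copy of \<open>\<ell>\<^sub>p\<^sup>m\<close>.\<close>
      have "\<exists>w\<in>carrier_vec m. q (J j w) < lp_norm p w / B"
      proof (rule ccontr)
        assume "\<not> ?thesis"
        moreover have "vnorm X (S (J j w)) \<le> B * lp_norm p w" if "w \<in> carrier_vec m" for w
          using S(2)[OF J_closed, of j w] J_norm[OF j that]
            mult_right_mono[OF \<open>C \<le> B\<close> lp_norm_nonneg, of p w] by simp
        ultimately have "fixes_copy B (lp_space p m) X Y T\<^sub>1"
          using C(1) \<open>C \<le> B\<close>
          by (intro fixes_copyI[OF hE _ module_hom_comp[OF J_hom[of j] operators_hom[OF S(1)]]])
            (auto simp: lp_space_simps q_def not_less)
        with m(2) show False ..
      qed
      then obtain w where w: "w \<in> carrier_vec m" "q (J j w) < lp_norm p w / B"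
        by blast
      have "0 < lp_norm p w / B"
        using q_nonneg[OF J_closed, of j w] w(2) by simp
      then have pos: "0 < lp_norm p w"
        using C(1) \<open>C \<le> B\<close> by (simp add: zero_less_divide_iff)
      define c :: 'k where "c = of_real (1 / lp_norm p w)"
      have c: "norm c = 1 / lp_norm p w"
        using pos by (simp add: c_def norm_divide)
      show ?thesis
      proof (intro bexI conjI)
        show "lp_norm p (c \<cdot>\<^sub>v w) = 1"
          using pos by (simp add: lp_norm_smult[OF p] c)
        show "q (J j (c \<cdot>\<^sub>v w)) \<le> 1 / B"
          using w pos by (simp add: J_smult q_smult[OF J_closed] c field_simps)
        show "c \<cdot>\<^sub>v w \<in> carrier_vec m"
          using w(1) by simp
      qed
    qed
    then obtain u where u: "\<And>j. j < n \<Longrightarrow> u j \<in> carrier_vec m"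
      "\<And>j. j < n \<Longrightarrow> lp_norm p (u j) = 1" "\<And>j. j < n \<Longrightarrow> q (J j (u j)) \<le> 1 / B"
      by metis
    \<comment> \<open>The isometric copy of \<open>\<ell>\<^sub>p\<^sup>n\<close> spanned by the chosen unit vectors.\<close>
    define V where "V a = blocks n m (\<lambda>j. a $ j \<cdot>\<^sub>v u j)" for a
    have V_closed: "V a \<in> carrier_vec (n * m)" for a
      by (simp add: V_def blocks_carrier)
    have V_hom: "V \<in> module_hom class_ring (lp_space p n) (lp_space p (n * m))"
    proof -
      have "V (a + b) = V a + V b" if "a \<in> carrier_vec n" "b \<in> carrier_vec n" for a b
        unfolding V_def using that u(1)
        by (subst blocks_add[symmetric]) (auto intro!: blocks_cong simp: add_smult_distrib_vec)
      moreover have "V (c \<cdot>\<^sub>v a) = c \<cdot>\<^sub>v V a" if "a \<in> carrier_vec n" for c a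
        unfolding V_def using that u(1)
        by (subst blocks_smult[symmetric]) (auto intro!: blocks_cong simp: smult_smult_assoc)
      ultimately show ?thesis
        by (simp add: module_hom_def lp_space_simps V_closed)
    qed
    have V_norm: "lp_norm p (V a) = lp_norm p a" if "a \<in> carrier_vec n" for a
      unfolding V_def using that u(1,2)
      by (subst lp_norm_blocks[OF p]) (auto intro!: lp_norm_cong simp: lp_norm_smult[OF p])
    have q_V: "q (V a) \<le> lp_norm p a / (2 * C)" if a: "a \<in> carrier_vec n" for a
    proof -
      have "0 \<cdot>\<^sub>v 0\<^sub>v (n * m) = (0\<^sub>v (n * m) :: 'k vec)"
        by auto
      then have "q (0\<^sub>v (n * m)) \<le> 0"
        using q_smult[OF zero_carrier_vec, of 0] by simp
      then have "q (V a) \<le> (\<Sum>j<n. q (blocks n m (\<lambda>i. if i = j then a $ i \<cdot>\<^sub>v u i else 0\<^sub>v m)))"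
        unfolding V_def using u(1) by (intro blocks_triangle q_add) auto
      also have "\<dots> = (\<Sum>j<n. norm (a $ j) * q (J j (u j)))"
      proof (rule sum.cong)
        fix j assume j: "j \<in> {..<n}"
        have "blocks n m (\<lambda>i. if i = j then a $ i \<cdot>\<^sub>v u i else 0\<^sub>v m) = J j (a $ j \<cdot>\<^sub>v u j)"
          unfolding J_def by (intro blocks_cong) auto
        then show "q (blocks n m (\<lambda>i. if i = j then a $ i \<cdot>\<^sub>v u i else 0\<^sub>v m))
            = norm (a $ j) * q (J j (u j))"
          using u(1) j by (simp add: J_smult q_smult[OF J_closed])
      qed simp
      also have "\<dots> \<le> (\<Sum>j<n. lp_norm p a * (1 / B))"
        using u(3) a q_nonneg[OF J_closed]
        by (intro sum_mono mult_mono norm_index_le_lp_norm[OF p] lp_norm_nonneg) auto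
      also have "\<dots> = lp_norm p a / (2 * C)"
        using \<open>1 \<le> n\<close> C(1) by (simp add: B_def)
      finally show ?thesis .
    qed
    show ?thesis
    proof (rule fixes_copy_perturb[OF hE assms(3) C(1)
          module_hom_comp[OF V_hom operators_hom[OF S(1)]] _ _ T\<^sub>1 T\<^sub>2 T], unfold lp_space_simps)
      fix a :: "'k vec" assume a: "a \<in> carrier_vec n"
      show "vnorm X (S (V a)) \<le> C * lp_norm p a"
        using S(2)[OF V_closed, of a] V_norm[OF a] by simp
      show "lp_norm p a / C \<le> vnorm Y (T (S (V a)))"
        using S(3)[OF V_closed, of a] V_norm[OF a] by simp
      show "vnorm Y (T\<^sub>1 (S (V a))) \<le> lp_norm p a / (2 * C)"
        using q_V[OF a] by (simp add: q_def)
    qed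
  qed
  then show ?thesis
    using C(1) by (auto simp: fixes_uniformly_lp_family intro!: exI[of _ "2 * C"])
qed

section \<open>The ideal of non-fixing operators\<close>

text \<open>
  If \<open>T\<close> fixed a copy of \<open>\<ell>\<^sub>p\<^sup>n\<close> with \<open>n\<close> larger than the rank of \<open>T\<close>, then \<open>T S\<close> would embed an
  \<open>n\<close>-dimensional space linearly into the range of \<open>T\<close>.
\<close>

lemma finite_rank_not_fixes_uniformly_lp:
  fixes X :: "('k::real_normed_field, 'a) normed_space"
  assumes p: "1 \<le> p" and "normed_vectorspace X" and "normed_vectorspace Y"
    and T: "T \<in> finite_rank_operators X Y"
  shows "\<not> fixes_uniformly (lp_family p) X Y T"
proof
  interpret X: normed_vectorspace X by fact
  interpret Y: normed_vectorspace Y by fact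
  note hX = X.homogeneous_norm
  define W where "W = Y\<lparr>carrier := T ` carrier X\<rparr>"
  have T_op: "T \<in> operators X Y" and fin: "vectorspace.fin_dim class_ring W"
    using T by (auto simp: finite_rank_operators_def W_def)
  interpret T: linear_map class_ring X Y T
    by unfold_locales (rule operators_hom[OF T_op])
  interpret W: vectorspace class_ring W
    using Y.subspace_is_vs[OF T.imT_is_subspace] by (simp add: W_def T.im_def)
  define n where "n = Suc W.dim"
  assume "fixes_uniformly (lp_family p) X Y T"
  then obtain C where C: "1 \<le> C" "fixes_copy C (lp_space p n) X Y T"
    by (auto simp: fixes_uniformly_lp_family n_def)
  interpret E: homogeneous_norm "lp_space p n :: ('k, 'k vec) normed_space"
    by (rule homogeneous_norm_lp_space[OF p])
  obtain S where S: "S \<in> operators (lp_space p n) X"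
    "\<And>x. x \<in> carrier (lp_space p n) \<Longrightarrow> vnorm (lp_space p n) x / C \<le> vnorm Y (T (S x))"
    using fixes_copyE[OF E.homogeneous_norm_axioms hX C(2)] by blast
  interpret V: vec_space "TYPE('k)" n .
  have hom: "(\<lambda>x. T (S x)) \<in> module_hom class_ring (module_vec TYPE('k) n) W"
    using module_hom_comp[OF operators_hom[OF S(1)] operators_hom[OF T_op]]
      operators_closed[OF S(1)]
    by (simp add: module_hom_def Pi_iff lp_space_simps module_vec_simps W_def)
  interpret L: linear_map class_ring "module_vec TYPE('k) n" W "\<lambda>x. T (S x)"
    by unfold_locales (rule hom)
  have "L.kerT = {\<zero>\<^bsub>module_vec TYPE('k) n\<^esub>}"
  proof -
    have "x = 0\<^sub>v n" if x: "x \<in> carrier_vec n" and "T (S x) = \<zero>\<^bsub>Y\<^esub>" for x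
    proof -
      have "vnorm (lp_space p n) x / C \<le> 0"
        using S(2)[of x] that homogeneous_norm.vnorm_zero[OF Y.homogeneous_norm]
        by (simp add: lp_space_simps)
      then have "vnorm (lp_space p n) x = 0"
        using C(1) E.vnorm_nonneg[of x] x by (simp add: lp_space_simps divide_le_0_iff)
      then show ?thesis
        using E.vnorm_eq_0_iff[of x] x by (simp add: lp_space_simps)
    qed
    then show ?thesis
      unfolding L.ker_def using L.f0_is_0 by (auto simp: module_vec_simps W_def)
  qed
  then have inj: "inj_on (\<lambda>x. T (S x)) (carrier (module_vec TYPE('k) n))"
    by (intro L.Ke0_imp_inj) simp
  interpret I: vectorspace class_ring "W\<lparr>carrier := L.imT\<rparr>"
    by (rule W.subspace_is_vs[OF L.imT_is_subspace])
  interpret LI: linear_map class_ring "module_vec TYPE('k) n" "W\<lparr>carrier := L.imT\<rparr>" "\<lambda>x. T (S x)"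
    by unfold_locales (use hom in \<open>auto simp: module_hom_def L.im_def\<close>)
  have surj: "(\<lambda>x. T (S x)) ` carrier (module_vec TYPE('k) n) = carrier (W\<lparr>carrier := L.imT\<rparr>)"
    by (simp add: L.im_def)
  have "I.dim = n"
    using LI.dim_eq[OF V.fin_dim inj surj] V.dim_is_n by simp
  moreover have "I.dim \<le> W.dim"
    by (rule W.subspace_dim[OF L.imT_is_subspace fin LI.surj_fin_dim[OF V.fin_dim surj]])
  ultimately show False
    by (simp add: n_def)
qed

lemma smult_operator_fixes_uniformly:
  assumes "\<And>E. E \<in> F \<Longrightarrow> homogeneous_norm E"
    and "normed_vectorspace X" and "normed_vectorspace Y" and T: "T \<in> operators X Y"
    and "fixes_uniformly F X Y (\<lambda>x\<in>carrier X. c \<odot>\<^bsub>Y\<^esub> T x)"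
  shows "fixes_uniformly F X Y T"
proof -
  interpret X: normed_vectorspace X by fact
  interpret Y: normed_vectorspace Y by fact
  have "restrict (\<lambda>x. x) (carrier X) \<in> operators X X"
    by (rule restrict_in_operators[OF X.homogeneous_norm, where M = 1]) (auto simp: module_hom_def)
  with assms(1) X.homogeneous_norm Y.homogeneous_norm show ?thesis
    by (rule fixes_uniformly_factor[where M = "norm c", OF _ _ _ _ T _ _ assms(5)])
      (simp_all add: Y.vnorm_smult operators_closed[OF T])
qed

text \<open>
  The two scalar fields are treated at once: rescaling a vector to norm one, the only step that
  calls for particular scalars, is possible as soon as the field contains the reals.
\<close>

lemma closed_operator_ideal_non_fixing_lp:
  assumes p: "1 \<le> p"
  shows "closed_operator_ideal (non_fixing (lp_family p) ::
    ('k::real_normed_field, 'a) normed_space \<Rightarrow> ('k, 'a) normed_space \<Rightarrow> ('a \<Rightarrow> 'a) set)"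
  unfolding closed_operator_ideal_def
proof (intro conjI allI impI ballI)
  let ?F = "lp_family p :: ('k, 'k vec) normed_space set"
  have hF: "homogeneous_norm E" if "E \<in> ?F" for E
    using that homogeneous_norm_lp_space[OF p] by (auto simp: lp_family_def)
  {
    fix X Y :: "('k, 'a) normed_space"
    assume "banach_space X" "banach_space Y"
    then have nX: "normed_vectorspace X" and nY: "normed_vectorspace Y"
      by (simp_all add: banach_space_def)
    interpret O: normed_vectorspace "op_space X Y"
      using nX nY by (rule normed_vectorspace_op_space)
    show finite_rank: "finite_rank_operators X Y \<subseteq> non_fixing ?F X Y"
      using finite_rank_not_fixes_uniformly_lp[OF p nX nY]
      by (auto simp: non_fixing_def finite_rank_operators_def)
    show "closedin (Metric_space.mtopology (operators X Y) (ndist (op_space X Y))) (non_fixing ?F X Y)"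
      by (rule closedin_non_fixing[OF hF nX nY])
    show "VectorSpace.subspace class_ring (non_fixing ?F X Y) (op_space X Y)"
    proof (intro VectorSpace.subspace.intro O.vectorspace_axioms LinearCombinations.submodule.intro
        O.module_axioms)
      show "non_fixing ?F X Y \<subseteq> carrier (op_space X Y)"
        by (auto simp: non_fixing_def op_space_simps)
      show "\<zero>\<^bsub>op_space X Y\<^esub> \<in> non_fixing ?F X Y"
      proof -
        \<comment> \<open>The zero operator is not bounded below even on a copy of the one-dimensional space.\<close>
        have "\<not> fixes_copy C (lp_space p 1) X Y (\<zero>\<^bsub>op_space X Y\<^esub>)" if "1 \<le> C" for C
        proof
          let ?e = "vec 1 (\<lambda>i. if i = 0 then 1 else 0) :: 'k vec"
          assume "fixes_copy C (lp_space p 1) X Y (\<zero>\<^bsub>op_space X Y\<^esub>)"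
          then obtain S where S: "S \<in> operators (lp_space p 1) X"
            "vnorm (lp_space p 1) ?e / C \<le> vnorm Y (\<zero>\<^bsub>op_space X Y\<^esub> (S ?e))"
            by (rule fixes_copyE[OF homogeneous_norm_lp_space[OF p]
                  normed_vectorspace.homogeneous_norm[OF nX]]) (auto simp: lp_space_simps)
          have "\<zero>\<^bsub>op_space X Y\<^esub> (S ?e) = \<zero>\<^bsub>Y\<^esub>"
            using operators_closed[OF S(1)] by (simp add: op_space_simps lp_space_simps)
          then have "1 / C \<le> 0"
            using S(2) lp_norm_single[OF p, of 0 1 "1 :: 'k"]
              homogeneous_norm.vnorm_zero[OF normed_vectorspace.homogeneous_norm[OF nY]]
            by (simp add: lp_space_simps)
          then show False
            using that by simp
        qed
        then show ?thesis
          using O.M.zero_closed unfolding op_space_simps(1)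
          by (auto simp: non_fixing_def fixes_uniformly_lp_family)
      qed
      fix S T and c :: 'k
      assume T: "T \<in> non_fixing ?F X Y"
      have "c \<odot>\<^bsub>op_space X Y\<^esub> T \<in> operators X Y"
        using T O.smult_closed[of c T] by (simp add: non_fixing_def op_space_simps)
      then show "c \<odot>\<^bsub>op_space X Y\<^esub> T \<in> non_fixing ?F X Y"
        using T smult_operator_fixes_uniformly[OF hF nX nY]
        by (auto simp: non_fixing_def op_space_simps)
      assume S: "S \<in> non_fixing ?F X Y"
      have "S \<oplus>\<^bsub>op_space X Y\<^esub> T \<in> operators X Y"
        using S T O.M.a_closed[of S T] by (simp add: non_fixing_def op_space_simps)
      then show "S \<oplus>\<^bsub>op_space X Y\<^esub> T \<in> non_fixing ?F X Y"
        using S T fixes_uniformly_lp_summand[OF p nX nY,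
            of S T "\<lambda>x\<in>carrier X. S x \<oplus>\<^bsub>Y\<^esub> T x"]
        by (auto simp: non_fixing_def op_space_simps)
    qed
  }
  fix W X Y Z :: "('k, 'a) normed_space" and R S T
  assume "banach_space W" "banach_space X" "banach_space Y" "banach_space Z"
  then interpret W: normed_vectorspace W + X: normed_vectorspace X + Y: normed_vectorspace Y
    + Z: normed_vectorspace Z
    by (simp_all add: banach_space_def)
  note hom = W.homogeneous_norm X.homogeneous_norm Y.homogeneous_norm Z.homogeneous_norm
  assume R: "R \<in> operators W X" and "T \<in> non_fixing ?F X Y" and S: "S \<in> operators Y Z"
  then have T: "T \<in> operators X Y" "\<not> fixes_uniformly ?F X Y T"
    by (simp_all add: non_fixing_def)
  let ?STR = "compose (carrier W) S (compose (carrier W) T R)"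
  have STR: "?STR = (\<lambda>w\<in>carrier W. S (T (R w)))"
    by (auto simp: compose_def)
  have "?STR \<in> operators W Z"
    unfolding STR
  proof (rule restrict_in_operators[OF hom(1)])
    show "(\<lambda>w. S (T (R w))) \<in> module_hom class_ring W Z"
      by (rule module_hom_comp[OF module_hom_comp[OF operators_hom[OF R] operators_hom[OF T(1)]]
            operators_hom[OF S]])
    fix w assume w: "w \<in> carrier W"
    note Rw = operators_closed[OF R w]
    note TRw = operators_closed[OF T(1) Rw]
    have "vnorm Z (S (T (R w))) \<le> op_norm Y Z S * vnorm Y (T (R w))"
      by (rule op_norm_bound[OF hom(3,4) S TRw])
    also have "\<dots> \<le> op_norm Y Z S * (op_norm X Y T * vnorm X (R w))"
      by (intro mult_left_mono op_norm_bound[OF hom(2,3) T(1) Rw] op_norm_nonneg[OF hom(3,4) S])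
    also have "\<dots> \<le> op_norm Y Z S * (op_norm X Y T * (op_norm W X R * vnorm W w))"
      by (intro mult_left_mono op_norm_bound[OF hom(1,2) R w] op_norm_nonneg[OF hom(3,4) S]
          op_norm_nonneg[OF hom(2,3) T(1)])
    finally show "vnorm Z (S (T (R w)))
        \<le> (op_norm Y Z S * op_norm X Y T * op_norm W X R) * vnorm W w"
      by (simp add: mult.assoc)
  qed
  moreover have "\<not> fixes_uniformly ?F W Z ?STR"
  proof
    assume STR_fixes: "fixes_uniformly ?F W Z ?STR"
    have dominated: "vnorm Z (?STR w) \<le> op_norm Y Z S * vnorm Y (T (R w))" if "w \<in> carrier W" for w
      using op_norm_bound[OF hom(3,4) S operators_closed[OF T(1) operators_closed[OF R that]]] that
      unfolding STR by simp
    have "fixes_uniformly ?F X Y T"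
      by (rule fixes_uniformly_factor[OF hF hom(1,3) R T(1) op_norm_nonneg[OF hom(3,4) S]
            dominated STR_fixes])
    with T(2) show False ..
  qed
  ultimately show "?STR \<in> non_fixing ?F W Z"
    by (simp add: non_fixing_def)
qed

theorem theorem1p2:
  fixes p :: ennreal
  assumes "1 \<le> p"
  shows
    "closed_operator_ideal
       (non_fixing (lp_family p) ::
          (real, 'a) normed_space \<Rightarrow> (real, 'a) normed_space \<Rightarrow> ('a \<Rightarrow> 'a) set) \<and>
     closed_operator_ideal
       (non_fixing (lp_family p) ::
          (complex, 'b) normed_space \<Rightarrow> (complex, 'b) normed_space \<Rightarrow> ('b \<Rightarrow> 'b) set)"
  by (intro conjI closed_operator_ideal_non_fixing_lp[OF assms])

end
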